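(* The curve $p\mapsto(p+c(p),c(p))$, $p\in\mathbb R^+=[0,\infty)$, is Lipschitz continuous.
   Context: Let $s\in(0,1)$, $n>2s$, and let $\Omega\subset\mathbb R^n$ be a bounded domain with Lipschitz boundary. Let $K:\mathbb R^n\setminus\{0\}\to(0,\infty)$ satisfy: (i) $mK\in L^1(\mathbb R^n)$ with $m(x)=\min\{|x|^2,1\}$; (ii) there is $\lambda>0$ with $K(x)\ge\lambda|x|^{-(n+2s)}$ for all $x\ne0$; (iii) $K(x)=K(-x)$. Put $Q=\mathbb R^{2n}\setminus((\mathbb R^n\setminus\Omega)\times(\mathbb R^n\setminus\Omega))$. Let $X$ be the space of measurable $u:\mathbb R^n\to\mathbb R$ with $u|_\Omega\in L^2(\Omega)$ and $(u(x)-u(y))\sqrt{K(x-y)}\in L^2(Q)$, and let $X_0=\{u\in X: u=0 \text{ a.e. in }\mathbb R^n\setminus\Omega\}$, a Hilbert space with norm $\|u\|_{X_0}=\left(\int_Q|u(x)-u(y)|^2K(x-y)\,dx\,dy\right)^{1/2}$. Write $u^+=\max(u,0)$. $\lambda_1=\inf\{\|u\|_{X_0}^2: u\in X_0,\ \int_\Omega u^2=1\}$ is a simple eigenvalue, attained by functions of constant sign; $\phi_1$ denotes the nonnegative minimizer with $\int_\Omega\phi_1^2=1$. Let $\mathcal P=\{u\in X_0:\int_\Omega u^2\,dx=1\}$ with the topology of $X_0$, and for $p\ge0$ let $J_p(u)=\|u\|_{X_0}^2-p\int_\Omega(u^+)^2\,dx$, $\Gamma=\{\gamma\in C([-1,1],\mathcal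 P):\gamma(-1)=-\phi_1,\ \gamma(1)=\phi_1\}$, and $c(p)=\inf_{\gamma\in\Gamma}\max_{u\in\gamma([-1,1])}J_p(u)$. *)

theory Defs
  imports "HOL-Analysis.Analysis"
begin

text \<open>
  Elements of the function spaces below are represented by functions on all of \<open>\<real>\<^sup>n\<close>;
  two functions represent the same element iff they agree almost everywhere. The kernel \<open>K\<close> is
  a total function whose value at \<open>0\<close> is irrelevant.
\<close>

text \<open>
  Near every boundary point, \<open>\<Omega>\<close> is the part of a ball lying strictly above the graph of
  a Lipschitz function in suitable orthonormal coordinates. The unit vector \<open>\<nu>\<close> is the vertical
  axis of these coordinates, and the hyperplane \<open>{y. y \<bullet> \<nu> = 0}\<close> plays the role of
  \<open>\<real>\<^sup>n\<^sup>-\<^sup>1\<close>.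
\<close>

definition lipschitz_boundary :: "('a::euclidean_space) set \<Rightarrow> bool" where
  "lipschitz_boundary \<Omega> \<longleftrightarrow>
     (\<forall>z \<in> frontier \<Omega>. \<exists>r>0. \<exists>\<nu> h L.
        norm \<nu> = 1 \<and> L-lipschitz_on {y. y \<bullet> \<nu> = 0} h \<and>
        \<Omega> \<inter> ball z r = {x \<in> ball z r. h (x - (x \<bullet> \<nu>) *\<^sub>R \<nu>) < x \<bullet> \<nu>})"

definition L2_on :: "('a::euclidean_space) set \<Rightarrow> ('a \<Rightarrow> real) \<Rightarrow> bool" where
  "L2_on S f \<longleftrightarrow> set_borel_measurable lebesgue S f \<and> set_integrable lebesgue S (\<lambda>x. (f x)\<^sup>2)"

definition Q_dom :: "(real ^ 'n) set \<Rightarrow> ((real ^ 'n) \<times> (real ^ 'n)) set" where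
  "Q_dom \<Omega> = UNIV - (UNIV - \<Omega>) \<times> (UNIV - \<Omega>)"

definition X_space :: "(real ^ 'n \<Rightarrow> real) \<Rightarrow> (real ^ 'n) set \<Rightarrow> (real ^ 'n \<Rightarrow> real) set" where
  "X_space K \<Omega> = {u. u \<in> borel_measurable lebesgue \<and> L2_on \<Omega> u \<and>
      L2_on (Q_dom \<Omega>) (\<lambda>(x, y). (u x - u y) * sqrt (K (x - y)))}"

definition X0_space :: "(real ^ 'n \<Rightarrow> real) \<Rightarrow> (real ^ 'n) set \<Rightarrow> (real ^ 'n \<Rightarrow> real) set" where
  "X0_space K \<Omega> = {u \<in> X_space K \<Omega>. AE x in lebesgue. x \<notin> \<Omega> \<longrightarrow> u x = 0}"

definition X0_norm :: "(real ^ 'n \<Rightarrow> real) \<Rightarrow> (real ^ 'n) set \<Rightarrow> (real ^ 'n \<Rightarrow> real) \<Rightarrow> real" where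
  "X0_norm K \<Omega> u =
     sqrt (set_lebesgue_integral lebesgue (Q_dom \<Omega>) (\<lambda>(x, y). \<bar>u x - u y\<bar>\<^sup>2 * K (x - y)))"

definition P_sphere :: "(real ^ 'n \<Rightarrow> real) \<Rightarrow> (real ^ 'n) set \<Rightarrow> (real ^ 'n \<Rightarrow> real) set" where
  "P_sphere K \<Omega> = {u \<in> X0_space K \<Omega>. set_lebesgue_integral lebesgue \<Omega> (\<lambda>x. (u x)\<^sup>2) = 1}"

definition lambda1 :: "(real ^ 'n \<Rightarrow> real) \<Rightarrow> (real ^ 'n) set \<Rightarrow> real" where
  "lambda1 K \<Omega> = (INF u \<in> P_sphere K \<Omega>. (X0_norm K \<Omega> u)\<^sup>2)"

definition is_phi1 :: "(real ^ 'n \<Rightarrow> real) \<Rightarrow> (real ^ 'n) set \<Rightarrow> (real ^ 'n \<Rightarrow> real) \<Rightarrow> bool" where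
  "is_phi1 K \<Omega> \<phi> \<longleftrightarrow> \<phi> \<in> P_sphere K \<Omega> \<and> (X0_norm K \<Omega> \<phi>)\<^sup>2 = lambda1 K \<Omega> \<and>
     (AE x in lebesgue. 0 \<le> \<phi> x)"

definition J_fun :: "(real ^ 'n \<Rightarrow> real) \<Rightarrow> (real ^ 'n) set \<Rightarrow> real \<Rightarrow> (real ^ 'n \<Rightarrow> real) \<Rightarrow> real" where
  "J_fun K \<Omega> p u =
     (X0_norm K \<Omega> u)\<^sup>2 - p * set_lebesgue_integral lebesgue \<Omega> (\<lambda>x. (max (u x) 0)\<^sup>2)"

text \<open>
  On representatives \<open>X0_norm\<close> is only a seminorm, so continuity of a path for the topology of
  \<open>X\<^sub>0\<close> is spelled out as convergence in this seminorm, and the endpoint conditions are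
  equalities almost everywhere.
\<close>

definition Gamma_paths ::
  "(real ^ 'n \<Rightarrow> real) \<Rightarrow> (real ^ 'n) set \<Rightarrow> (real ^ 'n \<Rightarrow> real) \<Rightarrow> (real \<Rightarrow> real ^ 'n \<Rightarrow> real) set" where
  "Gamma_paths K \<Omega> \<phi> = {\<gamma>.
      (\<forall>t \<in> {-1..1}. \<gamma> t \<in> P_sphere K \<Omega>) \<and>
      (\<forall>t \<in> {-1..1}.
         ((\<lambda>r. X0_norm K \<Omega> (\<lambda>x. \<gamma> r x - \<gamma> t x)) \<longlongrightarrow> 0) (at t within {-1..1})) \<and>
      (AE x in lebesgue. \<gamma> (-1) x = - \<phi> x) \<and>
      (AE x in lebesgue. \<gamma> 1 x = \<phi> x)}"

text \<open>
  The inner supremum is a maximum, since \<open>J_fun K \<Omega> p\<close> is continuous along the path and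
  \<open>{-1..1}\<close> is compact.
\<close>

definition c_level :: "(real ^ 'n \<Rightarrow> real) \<Rightarrow> (real ^ 'n) set \<Rightarrow> (real ^ 'n \<Rightarrow> real) \<Rightarrow> real \<Rightarrow> real" where
  "c_level K \<Omega> \<phi> p = (INF \<gamma> \<in> Gamma_paths K \<Omega> \<phi>. SUP u \<in> \<gamma> ` {-1..1}. J_fun K \<Omega> p u)"

end

theory Submission
  imports Defs
begin

text \<open>
  The functionals \<open>J\<^sub>p\<close> and \<open>J\<^sub>q\<close> differ by \<open>(q - p) \<integral>\<^sub>\<Omega> (u\<^sup>+)\<^sup>2\<close>, and \<open>0 \<le> \<integral>\<^sub>\<Omega> (u\<^sup>+)\<^sup>2 \<le> \<integral>\<^sub>\<Omega> u\<^sup>2 = 1\<close>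
  on the sphere \<open>P\<close>, so they are uniformly within \<open>\<bar>p - q\<bar>\<close> of each other there. Passing to suprema
  along a path (\<open>abs_SUP_diff_le\<close>) and then to the infimum over paths (\<open>abs_INF_diff_le\<close>) preserves
  this bound, because the set of admissible paths is the same for all \<open>p\<close>. Hence the level \<open>c\<close> is
  \<open>1\<close>-Lipschitz (\<open>c_level_lipschitz\<close>), and the curve, built from \<open>c\<close> and the identity by a sum and
  a pairing, is Lipschitz as well.
\<close>

text \<open>
  When the values are bounded above, this is the least upper bound property. Two functions at
  bounded distance are bounded above simultaneously; if neither is, no real number is an upper bound
  of either range, and both suprema are the same default value. Similarly both are \<open>Sup {}\<close> if
  \<open>A\<close> is empty.
\<close>

lemma abs_SUP_diff_le:
  fixes f g :: "'a \<Rightarrow> real"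
  assumes "\<And>x. x \<in> A \<Longrightarrow> \<bar>f x - g x\<bar> \<le> d" and "0 \<le> d"
  shows "\<bar>(SUP x\<in>A. f x) - (SUP x\<in>A. g x)\<bar> \<le> d"
proof -
  have bdd_transfer: "bdd_above (v ` A)"
    if bdd: "bdd_above (u ` A)" and near: "\<And>x. x \<in> A \<Longrightarrow> \<bar>u x - v x\<bar> \<le> d" for u v :: "'a \<Rightarrow> real"
  proof -
    obtain M where M: "\<And>x. x \<in> A \<Longrightarrow> u x \<le> M"
      using bdd by (auto simp: bdd_above_def)
    show ?thesis
    proof (rule bdd_aboveI2)
      fix x assume "x \<in> A"
      then show "v x \<le> M + d"
        using M[of x] near[of x] by linarith
    qed
  qed
  have one_sided: "(SUP x\<in>A. u x) \<le> (SUP x\<in>A. v x) + d"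
    if "A \<noteq> {}" "bdd_above (v ` A)" "\<And>x. x \<in> A \<Longrightarrow> \<bar>u x - v x\<bar> \<le> d" for u v :: "'a \<Rightarrow> real"
  proof (rule cSUP_least)
    fix x assume "x \<in> A"
    then show "u x \<le> (SUP x\<in>A. v x) + d"
      using cSUP_upper[OF _ that(2), of x] that(3)[of x] by linarith
  qed (rule that)
  have sym: "\<And>x. x \<in> A \<Longrightarrow> \<bar>g x - f x\<bar> \<le> d"
    using assms(1) by (simp add: abs_minus_commute)
  have bdd_iff: "bdd_above (f ` A) \<longleftrightarrow> bdd_above (g ` A)"
    using bdd_transfer[OF _ assms(1)] bdd_transfer[OF _ sym] by (rule iffI)
  consider "A = {}" | "A \<noteq> {}" "bdd_above (f ` A)" "bdd_above (g ` A)"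
    | "\<not> bdd_above (f ` A)" "\<not> bdd_above (g ` A)"
    using bdd_iff by metis
  then show ?thesis
  proof cases
    case 1
    then show ?thesis using assms(2) by simp
  next
    case 2
    then show ?thesis
      using one_sided[of g f] one_sided[of f g] assms(1) sym by (simp add: abs_le_iff)
  next
    case 3
    then have "\<And>z. (\<forall>y \<in> f ` A. y \<le> z) \<longleftrightarrow> (\<forall>y \<in> g ` A. y \<le> z)"
      unfolding bdd_above_def by blast
    then have "(SUP x\<in>A. f x) = (SUP x\<in>A. g x)"
      unfolding Sup_real_def by presburger
    then show ?thesis using assms(2) by simp
  qed
qed

lemma abs_INF_diff_le:
  fixes f g :: "'a \<Rightarrow> real"
  assumes "\<And>x. x \<in> A \<Longrightarrow> \<bar>f x - g x\<bar> \<le> d" and "0 \<le> d"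
  shows "\<bar>(INF x\<in>A. f x) - (INF x\<in>A. g x)\<bar> \<le> d"
proof -
  have "\<bar>(SUP x\<in>A. - f x) - (SUP x\<in>A. - g x)\<bar> \<le> d"
    using assms by (intro abs_SUP_diff_le) (auto simp: abs_minus_commute)
  then show ?thesis
    by (simp add: Inf_real_def image_image abs_minus_commute)
qed

lemma P_sphere_positive_part_bounds:
  assumes "u \<in> P_sphere K \<Omega>"
  defines "m \<equiv> set_lebesgue_integral lebesgue \<Omega> (\<lambda>x. (max (u x) 0)\<^sup>2)"
  shows "0 \<le> m" and "m \<le> 1"
proof -
  show "0 \<le> m"
    unfolding m_def set_lebesgue_integral_def by (intro integral_nonneg_AE) simp
  have "set_integrable lebesgue \<Omega> (\<lambda>x. (u x)\<^sup>2)"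
    using assms(1) by (auto simp: P_sphere_def X0_space_def X_space_def L2_on_def)
  then have "m \<le> set_lebesgue_integral lebesgue \<Omega> (\<lambda>x. (u x)\<^sup>2)"
    unfolding m_def set_lebesgue_integral_def set_integrable_def
    by (intro integral_mono') (auto simp: indicator_def max_def)
  then show "m \<le> 1"
    using assms(1) by (simp add: P_sphere_def)
qed

lemma J_fun_diff_le:
  assumes "u \<in> P_sphere K \<Omega>"
  shows "\<bar>J_fun K \<Omega> p u - J_fun K \<Omega> q u\<bar> \<le> \<bar>p - q\<bar>"
proof -
  define m where "m = set_lebesgue_integral lebesgue \<Omega> (\<lambda>x. (max (u x) 0)\<^sup>2)"
  have "\<bar>J_fun K \<Omega> p u - J_fun K \<Omega> q u\<bar> = \<bar>(q - p) * m\<bar>"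
    by (simp add: J_fun_def m_def algebra_simps)
  also have "\<dots> = \<bar>p - q\<bar> * m"
    using P_sphere_positive_part_bounds(1)[OF assms] by (simp add: m_def abs_mult abs_minus_commute)
  also have "\<dots> \<le> \<bar>p - q\<bar>"
    using P_sphere_positive_part_bounds(2)[OF assms] by (simp add: m_def mult_left_le)
  finally show ?thesis .
qed

lemma c_level_lipschitz: "1-lipschitz_on S (c_level K \<Omega> \<phi>)"
proof (rule lipschitz_onI)
  fix p q
  have "\<bar>(SUP u \<in> \<gamma> ` {-1..1}. J_fun K \<Omega> p u) - (SUP u \<in> \<gamma> ` {-1..1}. J_fun K \<Omega> q u)\<bar> \<le> \<bar>p - q\<bar>"
    if "\<gamma> \<in> Gamma_paths K \<Omega> \<phi>" for \<gamma>
    using that by (intro abs_SUP_diff_le J_fun_diff_le) (auto simp: Gamma_paths_def)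
  then show "dist (c_level K \<Omega> \<phi> p) (c_level K \<Omega> \<phi> q) \<le> 1 * dist p q"
    unfolding c_level_def dist_real_def by (simp add: abs_INF_diff_le)
qed simp

theorem proposition4p1:
  fixes s lam :: real
    and \<Omega> :: "(real ^ 'n) set"
    and K :: "real ^ 'n \<Rightarrow> real"
    and \<phi>\<^sub>1 :: "real ^ 'n \<Rightarrow> real"
  assumes "0 < s" and "s < 1" and "2 * s < real CARD('n)"
    and "open \<Omega>" and "connected \<Omega>" and "\<Omega> \<noteq> {}" and "bounded \<Omega>"
    and "lipschitz_boundary \<Omega>"
    and "\<And>x. x \<noteq> 0 \<Longrightarrow> 0 < K x"
    and "integrable lebesgue (\<lambda>x. min ((norm x)\<^sup>2) 1 * K x)"
    and "0 < lam"
    and "\<And>x. x \<noteq> 0 \<Longrightarrow> lam * norm x powr (- (real CARD('n) + 2 * s)) \<le> K x"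
    and "\<And>x. x \<noteq> 0 \<Longrightarrow> K x = K (- x)"
    and "is_phi1 K \<Omega> \<phi>\<^sub>1"
  shows "\<exists>L. L-lipschitz_on {0..} (\<lambda>p. (p + c_level K \<Omega> \<phi>\<^sub>1 p, c_level K \<Omega> \<phi>\<^sub>1 p))"
proof -
  have "(1 + 1)-lipschitz_on {0..} (\<lambda>p. p + c_level K \<Omega> \<phi>\<^sub>1 p)"
    by (intro lipschitz_on_add lipschitz_on_id c_level_lipschitz)
  from lipschitz_on_Pair[OF this c_level_lipschitz] show ?thesis ..
qed

end
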